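(* There exist a set $D$ of cardinality $\aleph_2$ and proper upward monotone quantifiers $P,Q\subseteq\mathcal P(D)$ such that $Q$ is a filter and $P$ dominates $Q$, but neither of the two equalities $$P\cdot Q=P\boxtimes Q,\qquad Q^d\cdot P^d=Q^d\boxtimes P^d$$ holds.
   Context: Work in ZFC. A (unary) quantifier on a nonempty set $D$ is a family $Q\subseteq\mathcal P(D)$ of subsets of $D$. It is upward monotone if $A\in Q$ and $A\subseteq B\subseteq D$ imply $B\in Q$; it is proper if $\varnothing\notin Q$ and $D\in Q$. A filter is a proper upward monotone quantifier closed under finite intersections. For $R\subseteq D^2$ put $R_x=\{y\in D:(x,y)\in R\}$ and $R^{-1}=\{(y,x):(x,y)\in R\}$. The iteration of $P$ and $Q$ is $P\cdot Q=\{R\subseteq D^2:\{x\in D:R_x\in Q\}\in P\}$. $P$ dominates $Q$ if for every $R\subseteq D^2$, $R\in P\cdot Q$ implies $R^{-1}\in Q\cdot P$. The branching product is $P\boxtimes Q=\{R\subseteq D^2:\exists A\in P\ \exists B\in Q\ (A\times B\subseteq R)\}$. The dual of $Q$ is $Q^d=\{A\subseteq D:D\setminus A\notin Q\}$. *)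

theory Defs
  imports Main
begin

unbundle cardinal_syntax

text \<open>
  The domain D is an explicit carrier set and all complements and relations are taken relative
  to it. The section of a relation R at x is the library image R `` {x}, which is a subset
  of D when R is a subset of D \<times> D.
\<close>

definition quantifier :: "'a set \<Rightarrow> 'a set set \<Rightarrow> bool" where
  "quantifier D Q \<longleftrightarrow> D \<noteq> {} \<and> Q \<subseteq> Pow D"

definition upward_monotone :: "'a set \<Rightarrow> 'a set set \<Rightarrow> bool" where
  "upward_monotone D Q \<longleftrightarrow> (\<forall>A B. A \<in> Q \<and> A \<subseteq> B \<and> B \<subseteq> D \<longrightarrow> B \<in> Q)"

definition proper :: "'a set \<Rightarrow> 'a set set \<Rightarrow> bool" where
  "proper D Q \<longleftrightarrow> {} \<notin> Q \<and> D \<in> Q"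

text \<open>
  The empty intersection is excluded because the library value of \<open>\<Inter>{}\<close> is the whole type;
  relative to D it would be D itself, which is in Q by properness.
\<close>

definition filter_on :: "'a set \<Rightarrow> 'a set set \<Rightarrow> bool" where
  "filter_on D Q \<longleftrightarrow>
     quantifier D Q \<and> proper D Q \<and> upward_monotone D Q \<and>
     (\<forall>F. finite F \<and> F \<noteq> {} \<and> F \<subseteq> Q \<longrightarrow> \<Inter>F \<in> Q)"

definition iteration :: "'a set \<Rightarrow> 'a set set \<Rightarrow> 'a set set \<Rightarrow> 'a rel set" where
  "iteration D P Q = {R. R \<subseteq> D \<times> D \<and> {x \<in> D. R `` {x} \<in> Q} \<in> P}"

definition dominates :: "'a set \<Rightarrow> 'a set set \<Rightarrow> 'a set set \<Rightarrow> bool" where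
  "dominates D P Q \<longleftrightarrow>
     (\<forall>R. R \<subseteq> D \<times> D \<longrightarrow> R \<in> iteration D P Q \<longrightarrow> R\<inverse> \<in> iteration D Q P)"

definition branching :: "'a set \<Rightarrow> 'a set set \<Rightarrow> 'a set set \<Rightarrow> 'a rel set" where
  "branching D P Q = {R. R \<subseteq> D \<times> D \<and> (\<exists>A\<in>P. \<exists>B\<in>Q. A \<times> B \<subseteq> R)}"

definition dual :: "'a set \<Rightarrow> 'a set set \<Rightarrow> 'a set set" where
  "dual D Q = {A. A \<subseteq> D \<and> D - A \<notin> Q}"

end

theory Submission
  imports Defs "HOL-Library.Countable_Set_Type"
begin

text \<open>
  Split a set \<open>D\<close> of cardinality \<open>\<aleph>\<^sub>2\<close> into two disjoint pieces \<open>C\<close> and \<open>E\<close> of the same cardinality.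
  Let \<open>P\<close> consist of the uncountable subsets of \<open>D\<close>, and let \<open>Q\<close> consist of those subsets
  that miss at most \<open>\<aleph>\<^sub>1\<close> points of \<open>C\<close> and only finitely many points of \<open>E\<close>.
  The threshold \<open>\<aleph>\<^sub>1\<close> for membership in \<open>P\<close> does not exceed the bound allowed on \<open>C\<close>, but
  it is larger than \<open>\<aleph>\<^sub>0\<close>, the least size forbidden on \<open>E\<close>. Domination therefore holds on
  the two pieces for different reasons, and each piece destroys one of the two equalities.

  Domination: suppose \<open>R\<^sub>x \<in> Q\<close> for uncountably many \<open>x\<close>, and call \<open>y\<close> bad if only countably
  many of these \<open>x\<close> satisfy \<open>R x y\<close>. On \<open>C\<close>, keep only \<open>\<aleph>\<^sub>1\<close> of the \<open>x\<close>; a bad \<open>y\<close> must be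
  missed by one of the remaining \<open>R\<^sub>x\<close>, so the bad points of \<open>C\<close> lie in a union of \<open>\<aleph>\<^sub>1\<close> sets of
  size at most \<open>\<aleph>\<^sub>1\<close>. On \<open>E\<close>, countably infinitely many bad points would together
  account for only countably many \<open>x\<close>, so some \<open>R\<^sub>x\<close> would miss all of them, although it
  misses only finitely many points of \<open>E\<close>. These arguments are \<open>bad_points_on_C\<close> and
  \<open>bad_points_on_E\<close>.

  The piece \<open>E\<close> breaks \<open>P \<cdot> Q = P \<boxtimes> Q\<close>: for an injection \<open>f\<close> from \<open>D\<close> to \<open>E\<close>, each section
  of \<open>y \<noteq> f x\<close> omits one point, but the sections over any infinite set jointly
  omit infinitely many points of \<open>E\<close>. The piece \<open>C\<close> breaks the dual equality: the
  relation \<open>x \<in> C \<and> x \<noteq> y\<close> has co-countable sections over \<open>C\<close>, which is too large to be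
  disjoint from a member of \<open>Q\<close>, but a rectangle \<open>A \<times> B\<close> inside it with \<open>B\<close> co-countable has
  a countable \<open>A \<subseteq> C\<close>, and the complement of such an \<open>A\<close> belongs to \<open>Q\<close>.
\<close>

section \<open>The first uncountable cardinals\<close>

lemma uncountable_iff_aleph1_ordLeq:
  "uncountable A \<longleftrightarrow> cardSuc natLeq \<le>o |A|"
proof -
  have "uncountable A \<longleftrightarrow> natLeq <o |A|"
    unfolding countable_card_le_natLeq
    by (rule not_ordLeq_iff_ordLess) (simp_all add: natLeq_Well_order card_of_Well_order)
  also have "\<dots> \<longleftrightarrow> cardSuc natLeq \<le>o |A|"
    by (rule cardSuc_ordLess_ordLeq) (simp_all add: natLeq_Card_order card_of_Card_order)
  finally show ?thesis .
qed

lemma infinite_Field_aleph1: "infinite (Field (cardSuc natLeq))"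
  by (simp add: cardSuc_finite[OF natLeq_Card_order] Field_natLeq)

lemma countable_ordLeq_aleph1:
  assumes "countable A"
  shows "|A| \<le>o cardSuc natLeq"
proof -
  have "|A| \<le>o natLeq"
    using assms by (simp add: countable_card_le_natLeq)
  then show ?thesis
    by (rule ordLeq_transitive) (simp add: cardSuc_ordLeq natLeq_Card_order)
qed

lemma uncountable_contains_aleph1:
  assumes "uncountable A"
  obtains A' where "A' \<subseteq> A" "uncountable A'" "|A'| \<le>o cardSuc natLeq"
proof -
  let ?F = "Field (cardSuc natLeq)"
  have F: "|?F| =o cardSuc natLeq"
    by (rule card_of_Field_ordIso) (simp add: cardSuc_Card_order natLeq_Card_order)
  have "cardSuc natLeq \<le>o |A|"
    using assms by (simp only: uncountable_iff_aleph1_ordLeq)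
  with F have "|?F| \<le>o |A|"
    by (rule ordIso_ordLeq_trans)
  from iffD1[OF internalize_card_of_ordLeq2 this]
  obtain A' where A': "A' \<subseteq> A" "|?F| =o |A'|"
    by (elim exE conjE)
  have "|A'| =o cardSuc natLeq"
    using ordIso_symmetric[OF A'(2)] F by (rule ordIso_transitive)
  then have "uncountable A'" "|A'| \<le>o cardSuc natLeq"
    by (simp_all only: ordIso_iff_ordLeq uncountable_iff_aleph1_ordLeq)
  with A'(1) show thesis
    by (rule that)
qed

lemma aleph2_not_ordLeq_aleph1:
  assumes "|A| =o cardSuc (cardSuc natLeq)"
  shows "\<not> |A| \<le>o cardSuc natLeq"
proof
  assume "|A| \<le>o cardSuc natLeq"
  then have "cardSuc (cardSuc natLeq) \<le>o cardSuc natLeq"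
    by (rule ordIso_ordLeq_trans[OF ordIso_symmetric[OF assms]])
  moreover have "cardSuc natLeq <o cardSuc (cardSuc natLeq)"
    by (simp add: cardSuc_greater cardSuc_Card_order natLeq_Card_order)
  ultimately show False
    using not_ordLess_ordLeq by blast
qed

lemma aleph2_uncountable:
  assumes "|A| =o cardSuc (cardSuc natLeq)"
  shows "uncountable A"
  using assms aleph2_not_ordLeq_aleph1 countable_ordLeq_aleph1 by blast

text \<open>
  By Cantor's theorem each passage to the power set climbs at least one successor cardinal.
\<close>

lemma ex_aleph2_set:
  "\<exists>D :: nat set set set. |D| =o cardSuc (cardSuc natLeq)"
proof -
  have card_orders: "Card_order natLeq" "Card_order (cardSuc natLeq)"
      "Card_order (cardSuc (cardSuc natLeq))"
    by (simp_all add: natLeq_Card_order cardSuc_Card_order)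
  have "natLeq =o |UNIV :: nat set|"
    using card_of_nat by (rule ordIso_symmetric)
  also have "|UNIV :: nat set| <o |UNIV :: nat set set|"
    using card_of_Pow[of "UNIV :: nat set"] by simp
  finally have "cardSuc natLeq \<le>o |UNIV :: nat set set|"
    by (rule cardSuc_least[OF card_orders(1) card_of_Card_order])
  also have "|UNIV :: nat set set| <o |UNIV :: nat set set set|"
    using card_of_Pow[of "UNIV :: nat set set"] by simp
  finally have "cardSuc (cardSuc natLeq) \<le>o |UNIV :: nat set set set|"
    by (rule cardSuc_least[OF card_orders(2) card_of_Card_order])
  moreover have F: "|Field (cardSuc (cardSuc natLeq))| =o cardSuc (cardSuc natLeq)"
    using card_orders(3) by (rule card_of_Field_ordIso)
  ultimately have "|Field (cardSuc (cardSuc natLeq))| \<le>o |UNIV :: nat set set set|"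
    by - (rule ordIso_ordLeq_trans)
  from iffD1[OF internalize_card_of_ordLeq2 this]
  obtain D :: "nat set set set" where "|Field (cardSuc (cardSuc natLeq))| =o |D|"
    by (elim exE conjE)
  then have "|D| =o cardSuc (cardSuc natLeq)"
    using F by (rule ordIso_transitive[OF ordIso_symmetric])
  then show ?thesis
    by (rule exI)
qed

lemma infinite_split_in_two:
  assumes "infinite D"
  obtains C E where "D = C \<union> E" "C \<inter> E = {}" "|C| =o |D|" "|E| =o |D|"
proof -
  have "|D <+> D| =o |D|"
    using assms card_of_mono1[OF subset_refl] by (rule card_of_Plus_infinite1)
  then obtain g where g: "bij_betw g (D <+> D) D"
    by (auto simp: card_of_ordIso[symmetric])
  have inj: "inj_on g (D <+> D)" and im: "g ` (D <+> D) = D"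
    using g by (auto simp: bij_betw_def)
  have "bij_betw (g \<circ> Inl) D (g ` Inl ` D)" "bij_betw (g \<circ> Inr) D (g ` Inr ` D)"
    using inj by (auto simp: bij_betw_def intro!: comp_inj_on elim: inj_on_subset)
  then have "|g ` Inl ` D| =o |D|" "|g ` Inr ` D| =o |D|"
    by (simp_all only: card_of_ordIsoI ordIso_symmetric)
  moreover have "D = g ` Inl ` D \<union> g ` Inr ` D"
    unfolding image_Un[symmetric] Plus_def[symmetric] by (rule im[symmetric])
  moreover have "g ` Inl ` D \<inter> g ` Inr ` D = {}"
    using inj_on_image_Int[OF inj, of "Inl ` D" "Inr ` D"] by (auto simp: Plus_def)
  ultimately show thesis
    by - (rule that)
qed

section \<open>The two quantifiers\<close>

definition uncountable_subsets :: "'a set \<Rightarrow> 'a set set" where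
  "uncountable_subsets D = {A. A \<subseteq> D \<and> uncountable A}"

definition co_aleph1_cofinite :: "'a set \<Rightarrow> 'a set \<Rightarrow> 'a set set" where
  "co_aleph1_cofinite C E =
     {B. B \<subseteq> C \<union> E \<and> |C - B| \<le>o cardSuc natLeq \<and> finite (E - B)}"

lemma uncountable_subsets_quantifier:
  assumes "uncountable D"
  shows "quantifier D (uncountable_subsets D)" "proper D (uncountable_subsets D)"
    "upward_monotone D (uncountable_subsets D)"
  using assms countable_subset
  by (auto simp: quantifier_def proper_def upward_monotone_def uncountable_subsets_def)

lemma co_aleph1_cofinite_mono:
  assumes "B \<in> co_aleph1_cofinite C E" "B \<subseteq> B'" "B' \<subseteq> C \<union> E"
  shows "B' \<in> co_aleph1_cofinite C E"
proof -
  have "C - B' \<subseteq> C - B" "E - B' \<subseteq> E - B"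
    using assms(2) by auto
  then have "|C - B'| \<le>o |C - B|" "finite (E - B')"
    using assms(1) by (auto simp: co_aleph1_cofinite_def card_of_mono1 intro: finite_subset)
  moreover have "|C - B| \<le>o cardSuc natLeq"
    using assms(1) by (simp add: co_aleph1_cofinite_def)
  ultimately show ?thesis
    using assms(3) by (auto simp: co_aleph1_cofinite_def intro: ordLeq_transitive)
qed

lemma co_aleph1_cofinite_Int:
  assumes "B \<in> co_aleph1_cofinite C E" "B' \<in> co_aleph1_cofinite C E"
  shows "B \<inter> B' \<in> co_aleph1_cofinite C E"
proof -
  have "|(C - B) \<union> (C - B')| \<le>o cardSuc natLeq"
    using assms
    by (intro card_of_Un_ordLeq_infinite_Field infinite_Field_aleph1)
      (auto simp: co_aleph1_cofinite_def cardSuc_Card_order natLeq_Card_order)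
  then show ?thesis
    using assms by (auto simp: co_aleph1_cofinite_def Diff_Int)
qed

lemma co_aleph1_cofinite_filter:
  assumes "infinite E"
  shows "filter_on (C \<union> E) (co_aleph1_cofinite C E)"
proof -
  have "\<Inter>F \<in> co_aleph1_cofinite C E"
    if "finite F" "F \<noteq> {}" "F \<subseteq> co_aleph1_cofinite C E" for F
    using that by (induction F rule: finite_ne_induct) (auto intro: co_aleph1_cofinite_Int)
  moreover have "proper (C \<union> E) (co_aleph1_cofinite C E)"
  proof -
    have diff: "C - (C \<union> E) = {}" "E - (C \<union> E) = {}"
      by auto
    show ?thesis
      using assms countable_ordLeq_aleph1[of "{}"]
      by (simp add: proper_def co_aleph1_cofinite_def diff)
  qed
  moreover have "upward_monotone (C \<union> E) (co_aleph1_cofinite C E)"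
    using co_aleph1_cofinite_mono by (auto simp: upward_monotone_def)
  moreover have "quantifier (C \<union> E) (co_aleph1_cofinite C E)"
    using assms by (auto simp: quantifier_def co_aleph1_cofinite_def)
  ultimately show ?thesis
    by (simp add: filter_on_def)
qed

section \<open>Domination\<close>

text \<open>
  Shrinking \<open>A\<close> to size \<open>\<aleph>\<^sub>1\<close> keeps it uncountable while making the union of the
  complements of the sections small: outside that union, \<open>y\<close> is related to every remaining \<open>x\<close>.
\<close>

lemma bad_points_on_C:
  assumes "uncountable A" and "\<And>x. x \<in> A \<Longrightarrow> |C - R `` {x}| \<le>o cardSuc natLeq"
  shows "|{y \<in> C. countable {x \<in> A. (x, y) \<in> R}}| \<le>o cardSuc natLeq"
proof -
  obtain A' where A': "A' \<subseteq> A" "uncountable A'" "|A'| \<le>o cardSuc natLeq"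
    using uncountable_contains_aleph1[OF assms(1)] .
  have "{y \<in> C. countable {x \<in> A. (x, y) \<in> R}} \<subseteq> (\<Union>x\<in>A'. C - R `` {x})"
  proof
    fix y assume y: "y \<in> {y \<in> C. countable {x \<in> A. (x, y) \<in> R}}"
    then have "\<not> A' \<subseteq> {x \<in> A. (x, y) \<in> R}"
      using A'(2) countable_subset by blast
    then show "y \<in> (\<Union>x\<in>A'. C - R `` {x})"
      using y A'(1) by auto
  qed
  then have "|{y \<in> C. countable {x \<in> A. (x, y) \<in> R}}| \<le>o |\<Union>x\<in>A'. C - R `` {x}|"
    by (rule card_of_mono1)
  moreover have "|\<Union>x\<in>A'. C - R `` {x}| \<le>o cardSuc natLeq"
    using A' assms(2)
    by (intro card_of_UNION_ordLeq_infinite_Field infinite_Field_aleph1)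
      (auto simp: cardSuc_Card_order natLeq_Card_order)
  ultimately show ?thesis
    by (rule ordLeq_transitive)
qed

text \<open>
  Countably many bad points use up only countably many elements of \<open>A\<close>, so an element left
  over would have a section that misses all of them.
\<close>

lemma bad_points_on_E:
  assumes "uncountable A" and cofinite: "\<And>x. x \<in> A \<Longrightarrow> finite (E - R `` {x})"
  shows "finite {y \<in> E. countable {x \<in> A. (x, y) \<in> R}}"
proof (rule ccontr)
  assume "infinite {y \<in> E. countable {x \<in> A. (x, y) \<in> R}}"
  then obtain N where N: "N \<subseteq> {y \<in> E. countable {x \<in> A. (x, y) \<in> R}}"
      "countable N" "infinite N"
    using infinite_countable_subset' by blast
  have "countable (\<Union>y\<in>N. {x \<in> A. (x, y) \<in> R})"
    using N(1,2) by auto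
  then have "\<not> A \<subseteq> (\<Union>y\<in>N. {x \<in> A. (x, y) \<in> R})"
    using assms(1) countable_subset by blast
  then obtain x where x: "x \<in> A" "\<forall>y\<in>N. (x, y) \<notin> R"
    by blast
  then have "N \<subseteq> E - R `` {x}"
    using N(1) by auto
  then show False
    using N(3) cofinite[OF x(1)] finite_subset by blast
qed

lemma uncountable_subsets_dominates:
  "dominates (C \<union> E) (uncountable_subsets (C \<union> E)) (co_aleph1_cofinite C E)"
  unfolding dominates_def
proof (intro allI impI)
  fix R :: "'a rel"
  let ?D = "C \<union> E" and ?P = "uncountable_subsets (C \<union> E)" and ?Q = "co_aleph1_cofinite C E"
  assume R: "R \<subseteq> ?D \<times> ?D" and it: "R \<in> iteration ?D ?P ?Q"
  define A where "A = {x \<in> ?D. R `` {x} \<in> ?Q}"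
  have A: "uncountable A"
    using it by (simp add: iteration_def uncountable_subsets_def A_def)
  define G where "G = {y \<in> ?D. R\<inverse> `` {y} \<in> ?P}"
  have bad: "countable {x \<in> A. (x, y) \<in> R}" if "y \<in> ?D - G" for y
  proof -
    have "R\<inverse> `` {y} \<subseteq> ?D"
      using R by auto
    then have "countable (R\<inverse> `` {y})"
      using that by (auto simp: G_def uncountable_subsets_def)
    then show ?thesis
      by (rule countable_subset[rotated]) auto
  qed
  have "|C - G| \<le>o |{y \<in> C. countable {x \<in> A. (x, y) \<in> R}}|"
    using bad by (intro card_of_mono1) auto
  moreover have "|{y \<in> C. countable {x \<in> A. (x, y) \<in> R}}| \<le>o cardSuc natLeq"
    using A by (rule bad_points_on_C) (auto simp: A_def co_aleph1_cofinite_def)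
  ultimately have "|C - G| \<le>o cardSuc natLeq"
    by (rule ordLeq_transitive)
  moreover have "finite {y \<in> E. countable {x \<in> A. (x, y) \<in> R}}"
    using A by (rule bad_points_on_E) (auto simp: A_def co_aleph1_cofinite_def)
  then have "finite (E - G)"
    by (rule finite_subset[rotated]) (use bad in auto)
  ultimately have "G \<in> ?Q"
    by (auto simp: co_aleph1_cofinite_def G_def)
  then show "R\<inverse> \<in> iteration ?D ?Q ?P"
    using R by (auto simp: iteration_def G_def)
qed

section \<open>Failure of the two equalities\<close>

text \<open>
  The injection makes infinitely many sections omit infinitely many points of \<open>E\<close> in total.
  It has to be defined on all of \<open>C \<union> E\<close>, because the uncountable side of a rectangle may lie
  inside \<open>C\<close>; the size of \<open>E\<close> provides the room for it.
\<close>

lemma iteration_neq_branching: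
  assumes "C \<inter> E = {}" and "uncountable (C \<union> E)" and "|C \<union> E| \<le>o |E|"
  defines "D \<equiv> C \<union> E"
  shows "iteration D (uncountable_subsets D) (co_aleph1_cofinite C E)
    \<noteq> branching D (uncountable_subsets D) (co_aleph1_cofinite C E)"
proof -
  obtain f where f: "inj_on f D" "f ` D \<subseteq> E"
    using assms(3) card_of_ordLeq[of D E] unfolding D_def by blast
  define R where "R = {(x, y). x \<in> D \<and> y \<in> D \<and> y \<noteq> f x}"
  have "R `` {x} \<in> co_aleph1_cofinite C E" if "x \<in> D" for x
  proof -
    have "R `` {x} = D - {f x}"
      using that by (auto simp: R_def)
    moreover have "C - (D - {f x}) = {}" "E - (D - {f x}) = {f x}" "D - {f x} \<subseteq> C \<union> E"
      using that f(2) assms(1) by (auto simp: D_def)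
    ultimately show ?thesis
      unfolding co_aleph1_cofinite_def mem_Collect_eq
      by (simp only: countable_ordLeq_aleph1 countable_empty finite.intros simp_thms)
  qed
  then have "{x \<in> D. R `` {x} \<in> co_aleph1_cofinite C E} = D"
    by blast
  then have "R \<in> iteration D (uncountable_subsets D) (co_aleph1_cofinite C E)"
    using assms(2) by (auto simp: iteration_def uncountable_subsets_def R_def D_def)
  moreover have "R \<notin> branching D (uncountable_subsets D) (co_aleph1_cofinite C E)"
  proof
    assume "R \<in> branching D (uncountable_subsets D) (co_aleph1_cofinite C E)"
    then obtain A B where AB: "A \<subseteq> D" "uncountable A" "finite (E - B)" "A \<times> B \<subseteq> R"
      by (auto simp: branching_def uncountable_subsets_def co_aleph1_cofinite_def)
    have "f ` A \<subseteq> E - B"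
      using AB f(2) by (auto simp: R_def)
    then have "finite (f ` A)"
      using AB(3) finite_subset by blast
    then have "finite A"
      using AB(1) f(1) finite_imageD inj_on_subset by blast
    then show False
      using AB(2) countable_finite by blast
  qed
  ultimately show ?thesis
    by blast
qed

text \<open>
  Membership in the dual of the uncountable sets means having a countable complement. So the
  relation \<open>x \<in> C \<and> x \<noteq> y\<close> has large sections exactly over \<open>C\<close>. In a rectangle \<open>A \<times> B\<close> below it,
  irreflexivity puts \<open>A\<close> inside the complement of \<open>B\<close>, and the restriction to \<open>C\<close> prevents \<open>A\<close>
  from meeting \<open>E\<close>, where already an infinite countable set belongs to the dual of the filter.
\<close>

lemma dual_iteration_neq_branching:
  assumes "C \<inter> E = {}" and "\<not> |C| \<le>o cardSuc natLeq"
  defines "D \<equiv> C \<union> E"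
  shows "iteration D (dual D (co_aleph1_cofinite C E)) (dual D (uncountable_subsets D))
    \<noteq> branching D (dual D (co_aleph1_cofinite C E)) (dual D (uncountable_subsets D))"
proof -
  define T where "T = {(x, y). x \<in> C \<and> y \<in> D \<and> y \<noteq> x}"
  have D: "uncountable D"
    using assms(2) countable_ordLeq_aleph1[of C] by (auto simp: D_def)
  have "T `` {x} \<in> dual D (uncountable_subsets D) \<longleftrightarrow> x \<in> C" if "x \<in> D" for x
  proof (cases "x \<in> C")
    case True
    then have "T `` {x} = D - {x}" "D - (D - {x}) = {x}"
      using that by (auto simp: T_def)
    then show ?thesis
      using True by (simp add: dual_def uncountable_subsets_def)
  next
    case False
    then have "T `` {x} = {}"
      by (auto simp: T_def)
    then show ?thesis
      using False D by (simp add: dual_def uncountable_subsets_def)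
  qed
  then have "{x \<in> D. T `` {x} \<in> dual D (uncountable_subsets D)} = C"
    by (auto simp: D_def)
  moreover have "C - (D - C) = C"
    by auto
  then have "C \<in> dual D (co_aleph1_cofinite C E)"
    using assms(2) by (simp add: dual_def co_aleph1_cofinite_def D_def)
  ultimately have "T \<in> iteration D (dual D (co_aleph1_cofinite C E)) (dual D (uncountable_subsets D))"
    by (auto simp: iteration_def T_def D_def)
  moreover have
    "T \<notin> branching D (dual D (co_aleph1_cofinite C E)) (dual D (uncountable_subsets D))"
  proof
    assume "T \<in> branching D (dual D (co_aleph1_cofinite C E)) (dual D (uncountable_subsets D))"
    then obtain A B where A: "A \<subseteq> D" "D - A \<notin> co_aleph1_cofinite C E"
        and B: "B \<subseteq> D" "countable (D - B)" and AB: "A \<times> B \<subseteq> T"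
      by (auto simp: branching_def uncountable_subsets_def dual_def)
    have "B \<noteq> {}"
      using B(2) D by auto
    then have "A \<subseteq> C"
      using AB by (auto simp: T_def)
    have "A \<subseteq> D - B"
      using A(1) AB by (auto simp: T_def)
    then have "countable A"
      using B(2) countable_subset by blast
    then have "|A| \<le>o cardSuc natLeq"
      by (rule countable_ordLeq_aleph1)
    moreover have "C - (D - A) = A" "E - (D - A) = {}" "D - A \<subseteq> C \<union> E"
      using \<open>A \<subseteq> C\<close> assms(1) by (auto simp: D_def)
    ultimately have "D - A \<in> co_aleph1_cofinite C E"
      unfolding co_aleph1_cofinite_def mem_Collect_eq
      by (simp only: finite.emptyI simp_thms)
    then show False
      using A(2) by blast
  qed
  ultimately show ?thesis
    by blast
qed

section \<open>The counterexample\<close>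

theorem theorem7p2:
  shows "\<exists>(D :: nat set set set) P Q.
    |D| =o cardSuc (cardSuc natLeq) \<and>
    quantifier D P \<and> proper D P \<and> upward_monotone D P \<and>
    quantifier D Q \<and> proper D Q \<and> upward_monotone D Q \<and>
    filter_on D Q \<and>
    dominates D P Q \<and>
    iteration D P Q \<noteq> branching D P Q \<and>
    iteration D (dual D Q) (dual D P) \<noteq> branching D (dual D Q) (dual D P)"
proof -
  obtain D :: "nat set set set" where D: "|D| =o cardSuc (cardSuc natLeq)"
    using ex_aleph2_set by blast
  have uncountable_D: "uncountable D"
    using D by (rule aleph2_uncountable)
  then have "infinite D"
    using countable_finite by blast
  then obtain C E where CE: "D = C \<union> E" "C \<inter> E = {}" "|C| =o |D|" "|E| =o |D|"
    by (rule infinite_split_in_two)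
  have "|C| =o cardSuc (cardSuc natLeq)"
    using CE(3) D by (rule ordIso_transitive)
  then have C: "\<not> |C| \<le>o cardSuc natLeq"
    by (rule aleph2_not_ordLeq_aleph1)
  have D_le_E: "|D| \<le>o |E|"
    using CE(4) by (simp add: ordIso_iff_ordLeq)
  have "infinite E"
    using card_of_ordIso_finite[OF CE(4)] \<open>infinite D\<close> by simp
  let ?P = "uncountable_subsets D" and ?Q = "co_aleph1_cofinite C E"
  have filter: "filter_on D ?Q"
    unfolding CE(1) using \<open>infinite E\<close> by (rule co_aleph1_cofinite_filter)
  then have "quantifier D ?Q" "proper D ?Q" "upward_monotone D ?Q"
    by (simp_all add: filter_on_def)
  moreover have "quantifier D ?P" "proper D ?P" "upward_monotone D ?P"
    using uncountable_D by (rule uncountable_subsets_quantifier)+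
  moreover have "dominates D ?P ?Q"
    unfolding CE(1) by (rule uncountable_subsets_dominates)
  moreover have "iteration D ?P ?Q \<noteq> branching D ?P ?Q"
    using iteration_neq_branching[OF CE(2)] uncountable_D D_le_E unfolding CE(1) .
  moreover have "iteration D (dual D ?Q) (dual D ?P) \<noteq> branching D (dual D ?Q) (dual D ?P)"
    using dual_iteration_neq_branching[OF CE(2) C] unfolding CE(1) .
  ultimately show ?thesis
    using D filter by - (rule exI[of _ D], rule exI[of _ ?P], rule exI[of _ ?Q], intro conjI)
qed

end
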